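(* Let $k$ be a reflection for an involutive solution $(X,r)$, and let $\varphi,\psi\colon X\to X$ be two maps such that, for all $a\in X$, $$\varphi\lambda_a=\lambda_a\varphi,\quad \rho_{\varphi(a)}=\rho_a,\qquad \psi\lambda_a=\lambda_a\psi,\quad \rho_{\psi(a)}=\rho_a.$$ Then the map $\varphi k\psi$ is a reflection for $(X,r)$.
   Context: For a map $\phi\colon X^m\to X^m$, $\phi_i$ denotes the map on $X^n$ that applies $\phi$ to the $m$ consecutive coordinates starting at position $i$ and is the identity on the others; products of maps denote composition, the rightmost map being applied first. A solution $(X,r)$ is a set $X$ with a map $r\colon X\times X\to X\times X$ satisfying the Yang–Baxter equation $r_1r_2r_1=r_2r_1r_2$ on $X^3$; write $r(a,b)=(\lambda_a(b),\rho_b(a))$. It is involutive if $r^2=\mathrm{Id}$. A reflection for $(X,r)$ is a map $k\colon X\to X$ with $r k_2 r k_2=k_2 r k_2 r$ on $X^2$. *)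

theory Defs imports Main begin

text \<open>The set \<open>X\<close> is the type \<open>'a\<close>, and \<open>X\<^sup>3\<close> is \<open>'a \<times> 'a \<times> 'a\<close>. In the names below the numeral is the
  (1-based) position of the first coordinate the map is applied to.\<close>

definition on3_1 :: "('a \<times> 'a \<Rightarrow> 'a \<times> 'a) \<Rightarrow> 'a \<times> 'a \<times> 'a \<Rightarrow> 'a \<times> 'a \<times> 'a" where
  "on3_1 r = (\<lambda>(a, b, c). case r (a, b) of (a', b') \<Rightarrow> (a', b', c))"

definition on3_2 :: "('a \<times> 'a \<Rightarrow> 'a \<times> 'a) \<Rightarrow> 'a \<times> 'a \<times> 'a \<Rightarrow> 'a \<times> 'a \<times> 'a" where
  "on3_2 r = (\<lambda>(a, b, c). case r (b, c) of (b', c') \<Rightarrow> (a, b', c'))"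

definition on2_2 :: "('a \<Rightarrow> 'a) \<Rightarrow> 'a \<times> 'a \<Rightarrow> 'a \<times> 'a" where
  "on2_2 k = (\<lambda>(a, b). (a, k b))"

definition solution :: "('a \<times> 'a \<Rightarrow> 'a \<times> 'a) \<Rightarrow> bool" where
  "solution r \<longleftrightarrow> on3_1 r \<circ> on3_2 r \<circ> on3_1 r = on3_2 r \<circ> on3_1 r \<circ> on3_2 r"

definition involutive_solution :: "('a \<times> 'a \<Rightarrow> 'a \<times> 'a) \<Rightarrow> bool" where
  "involutive_solution r \<longleftrightarrow> solution r \<and> r \<circ> r = id"

text \<open>The components in \<open>r (a, b) = (\<lambda>\<^sub>a b, \<rho>\<^sub>b a)\<close>: the first argument after \<open>r\<close> is the subscript.\<close>

definition lam :: "('a \<times> 'a \<Rightarrow> 'a \<times> 'a) \<Rightarrow> 'a \<Rightarrow> 'a \<Rightarrow> 'a" where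
  "lam r a b = fst (r (a, b))"

definition rho :: "('a \<times> 'a \<Rightarrow> 'a \<times> 'a) \<Rightarrow> 'a \<Rightarrow> 'a \<Rightarrow> 'a" where
  "rho r b a = snd (r (a, b))"

definition reflection :: "('a \<times> 'a \<Rightarrow> 'a \<times> 'a) \<Rightarrow> ('a \<Rightarrow> 'a) \<Rightarrow> bool" where
  "reflection r k \<longleftrightarrow> r \<circ> on2_2 k \<circ> r \<circ> on2_2 k = on2_2 k \<circ> r \<circ> on2_2 k \<circ> r"

end

theory Submission imports Defs begin

text \<open>Write \<open>f\<^sub>1\<close> and \<open>f\<^sub>2\<close> for the action of \<open>f\<close> on the first and on the second coordinate of a pair.
  The hypotheses on \<open>\<phi>\<close> and \<open>\<psi>\<close> say precisely that each of them slides through \<open>r\<close> from the second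
  coordinate to the first, \<open>r \<phi>\<^sub>2 = \<phi>\<^sub>1 r\<close>, and involutivity turns this into sliding back,
  \<open>r \<phi>\<^sub>1 = \<phi>\<^sub>2 r\<close>. Maps on different coordinates commute, so in both sides of the reflection equation for
  \<open>\<phi> k \<psi>\<close> every \<open>\<phi>\<close> can be moved to the far left and every \<open>\<psi>\<close> to the far right. Two factors of each
  kind arrive there on different coordinates, and the equation becomes
  \[\phi_1 \phi_2\, (r k_2 r k_2)\, \psi_1 \psi_2 = \phi_1 \phi_2\, (k_2 r k_2 r)\, \psi_1 \psi_2 ,\]
  which is the reflection equation for \<open>k\<close> between the same two outer maps.\<close>

lemma slide_left:
  assumes "f \<circ> lam r (fst p) = lam r (fst p) \<circ> f" and "rho r (f (snd p)) = rho r (snd p)"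
  shows "r (map_prod id f p) = map_prod f id (r p)"
proof (rule prod_eqI)
  show "fst (r (map_prod id f p)) = fst (map_prod f id (r p))"
    using fun_cong[OF assms(1), of "snd p"] by (cases p) (simp add: lam_def)
  show "snd (r (map_prod id f p)) = snd (map_prod f id (r p))"
    using fun_cong[OF assms(2), of "fst p"] by (cases p) (simp add: rho_def)
qed

text \<open>Conjugating the intertwining relation with \<open>r = r\<^sup>-\<^sup>1\<close> exchanges the roles of the two maps.\<close>

lemma involution_intertwines_back:
  assumes "r \<circ> r = id" and "\<And>p. r (g p) = h (r p)"
  shows "r (h p) = g (r p)"
proof -
  have r_r: "r (r q) = q" for q
    using fun_cong[OF assms(1), of q] by simp
  have "r (h p) = r (h (r (r p)))"
    by (simp add: r_r)
  also have "\<dots> = r (r (g (r p)))"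
    by (simp only: assms(2))
  finally show ?thesis
    by (simp only: r_r)
qed

lemma map_prod_fst_snd_commute:
  "map_prod id g (map_prod f id p) = map_prod f id (map_prod id g p)"
  by (cases p) simp

theorem proposition3p5:
  fixes r :: "'a \<times> 'a \<Rightarrow> 'a \<times> 'a" and k \<phi> \<psi> :: "'a \<Rightarrow> 'a"
  assumes "involutive_solution r"
    and "reflection r k"
    and "\<And>a. \<phi> \<circ> lam r a = lam r a \<circ> \<phi>" and "\<And>a. rho r (\<phi> a) = rho r a"
    and "\<And>a. \<psi> \<circ> lam r a = lam r a \<circ> \<psi>" and "\<And>a. rho r (\<psi> a) = rho r a"
  shows "reflection r (\<phi> \<circ> k \<circ> \<psi>)"
proof -
  let ?k2 = "map_prod id k"
  let ?\<phi>1 = "map_prod \<phi> id" and ?\<phi>2 = "map_prod id \<phi>"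
  let ?\<psi>1 = "map_prod \<psi> id" and ?\<psi>2 = "map_prod id \<psi>"
  let ?t = "\<lambda>p. ?\<phi>2 (?k2 (?\<psi>2 p))"
  have on2: "on2_2 f = map_prod id f" for f :: "'a \<Rightarrow> 'a"
    by (auto simp: on2_2_def)
  have invol: "r \<circ> r = id"
    using assms(1) by (simp add: involutive_solution_def)
  have \<phi>_left: "r (?\<phi>2 p) = ?\<phi>1 (r p)" for p
    by (rule slide_left) (rule assms)+
  have \<phi>_right: "r (?\<phi>1 p) = ?\<phi>2 (r p)" for p
    by (rule involution_intertwines_back[where g = ?\<phi>2 and h = ?\<phi>1, OF invol \<phi>_left])
  have \<psi>_left: "r (?\<psi>2 p) = ?\<psi>1 (r p)" for p
    by (rule slide_left) (rule assms)+
  have \<psi>_right: "r (?\<psi>1 p) = ?\<psi>2 (r p)" for p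
    by (rule involution_intertwines_back[where g = ?\<psi>2 and h = ?\<psi>1, OF invol \<psi>_left])
  \<comment> \<open>Between two copies of \<open>k\<^sub>2\<close>, both inner maps leave through \<open>r\<close> onto the first coordinate,
    where \<open>k\<^sub>2\<close> no longer separates them from the outside.\<close>
  have middle: "?k2 (?\<psi>2 (r (?\<phi>2 (?k2 p)))) = ?\<phi>1 (?k2 (r (?k2 (?\<psi>1 p))))" for p
    by (simp only: \<phi>_left \<psi>_right[symmetric] map_prod_fst_snd_commute)
  have k: "r (?k2 (r (?k2 p))) = ?k2 (r (?k2 (r p)))" for p
    using fun_cong[OF assms(2)[unfolded reflection_def on2], of p] by simp
  have "r (?t (r (?t p))) = ?t (r (?t (r p)))" for p
  proof -
    have "r (?t (r (?t p))) = r (?\<phi>2 (?\<phi>1 (?k2 (r (?k2 (?\<psi>1 (?\<psi>2 p)))))))"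
      by (simp only: middle)
    also have "\<dots> = ?\<phi>1 (?\<phi>2 (r (?k2 (r (?k2 (?\<psi>1 (?\<psi>2 p)))))))"
      by (simp only: \<phi>_left \<phi>_right)
    also have "\<dots> = ?\<phi>1 (?\<phi>2 (?k2 (r (?k2 (r (?\<psi>1 (?\<psi>2 p)))))))"
      by (simp only: k)
    also have "\<dots> = ?\<phi>2 (?\<phi>1 (?k2 (r (?k2 (?\<psi>1 (?\<psi>2 (r p)))))))"
      by (simp only: \<psi>_left \<psi>_right map_prod_fst_snd_commute)
    also have "\<dots> = ?t (r (?t (r p)))"
      by (simp only: middle)
    finally show ?thesis .
  qed
  moreover have "map_prod id (\<phi> \<circ> k \<circ> \<psi>) p = ?t p" for p :: "'a \<times> 'a"
    by (cases p) simp
  ultimately show ?thesis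
    unfolding reflection_def on2 by (simp only: fun_eq_iff comp_apply simp_thms)
qed

end
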